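(* For any integers $k \ge 0$ and $n \ge 1$, we have $$\rho(n;k) \ \ge\ \Bigl\lceil \sqrt{(2k+1)\bigl(n-\tfrac14\bigr)} - \tfrac{k}{2} \Bigr\rceil .$$
   Context: A generic sequence of length $n$ is a sequence of pairwise distinct real numbers $a_1,\dots,a_n$. For an integer $k\ge 0$, a $k$-modal subsequence of length $t$ of a generic sequence is a subsequence $b_1,\dots,b_t$ of $a_1,\dots,a_n$ such that there exist indices $1=i_0\le i_1\le\dots\le i_k\le i_{k+1}=t$ for which one of the following holds: (1) for all $j\in\{0,1,\dots,k\}$, $b_{i_j}<b_{i_j+1}<\dots<b_{i_{j+1}}$ if $j$ is odd and $b_{i_j}>b_{i_j+1}>\dots>b_{i_{j+1}}$ if $j$ is even; or (2) for all $j\in\{0,1,\dots,k\}$, $b_{i_j}>b_{i_j+1}>\dots>b_{i_{j+1}}$ if $j$ is odd and $b_{i_j}<b_{i_j+1}<\dots<b_{i_{j+1}}$ if $j$ is even. (When $i_j=i_{j+1}$ the corresponding condition is vacuous.) $\rho(n;k)$ denotes the largest integer such that every generic sequence of length $n$ contains a $k$-modal subsequence of length $\rho(n;k)$. *)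

theory Defs
  imports Complex_Main "HOL-Library.Sublist"
begin

definition generic_seq :: "nat \<Rightarrow> real list \<Rightarrow> bool" where
  "generic_seq n a \<longleftrightarrow> length a = n \<and> distinct a"

definition increasing_between :: "real list \<Rightarrow> nat \<Rightarrow> nat \<Rightarrow> bool" where
  "increasing_between b l r \<longleftrightarrow> (\<forall>m. l \<le> m \<and> m < r \<longrightarrow> b ! m < b ! Suc m)"

definition decreasing_between :: "real list \<Rightarrow> nat \<Rightarrow> nat \<Rightarrow> bool" where
  "decreasing_between b l r \<longleftrightarrow> (\<forall>m. l \<le> m \<and> m < r \<longrightarrow> b ! m > b ! Suc m)"

text \<open>
  List positions count from 0, so the breakpoints
  \<open>1 = i\<^sub>0 \<le> i\<^sub>1 \<le> \<dots> \<le> i\<^sub>k\<^sub>+\<^sub>1 = t\<close> are all shifted down by one. The condition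
  on the last breakpoint is written with \<open>Suc\<close> to avoid truncated subtraction;
  in particular the empty list is not \<open>k\<close>-modal.
\<close>

definition k_modal :: "nat \<Rightarrow> real list \<Rightarrow> bool" where
  "k_modal k b \<longleftrightarrow>
    (\<exists>i :: nat \<Rightarrow> nat.
      i 0 = 0 \<and> Suc (i (Suc k)) = length b \<and> (\<forall>j\<le>k. i j \<le> i (Suc j)) \<and>
      ((\<forall>j\<le>k. (odd j \<longrightarrow> increasing_between b (i j) (i (Suc j))) \<and>
               (even j \<longrightarrow> decreasing_between b (i j) (i (Suc j)))) \<or>
       (\<forall>j\<le>k. (odd j \<longrightarrow> decreasing_between b (i j) (i (Suc j))) \<and>
               (even j \<longrightarrow> increasing_between b (i j) (i (Suc j))))))"

definition has_k_modal_subseq :: "nat \<Rightarrow> nat \<Rightarrow> real list \<Rightarrow> bool" where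
  "has_k_modal_subseq k t a \<longleftrightarrow> (\<exists>b. subseq b a \<and> length b = t \<and> k_modal k b)"

definition rho :: "nat \<Rightarrow> nat \<Rightarrow> nat" where
  "rho n k = (GREATEST t. \<forall>a. generic_seq n a \<longrightarrow> has_k_modal_subseq k t a)"

text \<open>The maximum exists for \<open>n \<ge> 1\<close>, so the value of \<open>rho\<close> is meaningful there.\<close>

lemma
  assumes "n \<ge> 1"
  shows rho_attained: "generic_seq n a \<Longrightarrow> has_k_modal_subseq k (rho n k) a"
    and rho_greatest: "(\<And>a. generic_seq n a \<Longrightarrow> has_k_modal_subseq k t a) \<Longrightarrow> t \<le> rho n k"
proof -
  let ?P = "\<lambda>t. \<forall>a. generic_seq n a \<longrightarrow> has_k_modal_subseq k t a"
  have one: "?P 1"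
  proof (intro allI impI)
    fix a assume "generic_seq n a"
    with assms obtain x xs where a: "a = x # xs"
      by (cases a) (auto simp: generic_seq_def)
    have "k_modal k [x]"
      unfolding k_modal_def increasing_between_def decreasing_between_def
      by (rule exI[of _ "\<lambda>_. 0"]) simp
    with a show "has_k_modal_subseq k 1 a"
      unfolding has_k_modal_subseq_def by (intro exI[of _ "[x]"]) simp
  qed
  have bound: "t \<le> n" if "?P t" for t
  proof -
    have g: "generic_seq n (map real [0..<n])"
      by (simp add: generic_seq_def distinct_map)
    with that obtain b where "subseq b (map real [0..<n])" "length b = t"
      unfolding has_k_modal_subseq_def by blast
    then show ?thesis
      using list_emb_length by fastforce
  qed
  show "generic_seq n a \<Longrightarrow> has_k_modal_subseq k (rho n k) a"
    using GreatestI_nat[of ?P, OF one] bound unfolding rho_def by blast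
  show "(\<And>a. generic_seq n a \<Longrightarrow> has_k_modal_subseq k t a) \<Longrightarrow> t \<le> rho n k"
    using Greatest_le_nat[of ?P t n] bound unfolding rho_def by blast
qed

end

theory Submission
  imports Defs
begin

text \<open>
  Let \<open>u\<^sub>j\<close> and \<open>d\<^sub>j\<close> be the maximal lengths of subsequences with at most \<open>j\<close> turns that start
  upwards and downwards. Swapping the tails of two optimal paths at a suitable moment yields
  \<open>d\<^sub>j\<^sub>+\<^sub>2 + u\<^sub>j \<le> d\<^sub>j\<^sub>+\<^sub>1 + u\<^sub>j\<^sub>+\<^sub>1\<close>, and the same with \<open>u\<close> and \<open>d\<close> interchanged. Hence one can choose
  a price \<open>\<lambda>\<close> for peaks and a price \<open>\<mu>\<close> for valleys such that
  \<open>u\<^sub>j\<close> minus the price of \<open>j\<close> turns and \<open>d\<^sub>j\<close> minus the price of \<open>j\<close> turns are both maximal at \<open>j = k\<close>.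

  Label every entry with the pair \<open>(P, Q)\<close> of the best such values of paths that start at it upwards
  and downwards. The labels are pairwise distinct integer points with \<open>-\<lambda> \<le> P - Q \<le> \<mu>\<close>. If \<open>t\<close> bounds
  \<open>u\<^sub>k\<close> and \<open>d\<^sub>k\<close>, then \<open>P\<close> and \<open>Q\<close> lie between 1 and \<open>t\<close> minus the price of \<open>k\<close> turns. Counting
  the lattice points of this hexagon and optimising over \<open>\<lambda>\<close> and \<open>\<mu>\<close> bounds the length \<open>n\<close> by
  \<open>(t + k/2)\<^sup>2 / (2k + 1) + 1/4\<close>.
\<close>

subsection \<open>Turns and the exchange of tails\<close>

definition step :: "bool \<Rightarrow> 'a::linorder \<Rightarrow> 'a \<Rightarrow> bool" where
  "step s x y \<longleftrightarrow> (if s then x < y else y < x)"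

lemma step_trans: "step s x y \<Longrightarrow> step s y z \<Longrightarrow> step s x z"
  by (auto simp: step_def split: if_splits)

lemma step_Not: "x \<noteq> y \<Longrightarrow> step (\<not> s) x y \<longleftrightarrow> \<not> step s x y"
  by (auto simp: step_def)

lemma step_linear: "x \<noteq> y \<Longrightarrow> \<not> step s x y \<longleftrightarrow> step s y x"
  by (auto simp: step_def)

text \<open>\<open>s\<close> is the direction of arrival at the first entry, so a first step against
  \<open>s\<close> already counts as a turn.\<close>

fun turns :: "bool \<Rightarrow> 'a::linorder list \<Rightarrow> nat" where
  "turns s [] = 0"
| "turns s [x] = 0"
| "turns s (x # y # zs) = (if step s x y then turns s (y # zs) else Suc (turns (\<not> s) (y # zs)))"

lemma turns_Not_le: "turns (\<not> s) xs \<le> Suc (turns s xs)"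
proof (induction s xs rule: turns.induct)
  case (3 s x y zs)
  then show ?case by (cases "x = y") (auto simp: step_Not)
qed auto

lemma turns_le_Not: "turns s xs \<le> Suc (turns (\<not> s) xs)"
  using turns_Not_le[of "\<not> s" xs] by simp

lemma turns_mono: "step s x y \<Longrightarrow> turns s (x # bs) \<le> turns s (y # bs)"
  by (cases bs) (auto simp: turns_le_Not dest: step_trans)

lemma turns_tl_le: "turns s bs \<le> turns s (y # bs)"
  by (cases bs) (auto simp: turns_le_Not)

text \<open>The two heads cost nothing beyond a change of direction: dropping \<open>y\<close>,
  reversing, and entering the tail from \<open>x\<close> adds at most one turn in total.\<close>

lemma turns_Cons_Not_le: "turns (\<not> s) (x # bs) \<le> Suc (turns s (y # bs))"
proof (cases bs)
  case (Cons b cs)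
  have "turns (\<not> s) (x # bs) \<le> Suc (turns s bs)"
    using Cons turns_Not_le[of s bs] by auto
  with turns_tl_le[of s bs y] show ?thesis by linarith
qed simp

text \<open>
  Read \<open>x\<close> and \<open>y\<close> as the current ends of two paths \<open>A\<close> and \<open>B\<close> scanned from left to right,
  \<open>as\<close> and \<open>bs\<close> as their remaining parts, and \<open>\<alpha>\<close> and \<open>\<beta>\<close> as the numbers of turns they
  have left. While \<open>\<alpha> - \<beta> = 1\<close> both paths move in the same direction, and their tails can be
  swapped without extra turns as soon as \<open>A\<close> would overtake \<open>B\<close> or make a turn itself.
\<close>

lemma exchange:
  assumes "distinct zs" "x \<notin> set zs" "y \<notin> set zs" "subseq as zs" "subseq bs zs"
    and "turns p (x # as) \<le> \<alpha>" "turns q (y # bs) \<le> \<beta>" "\<beta> < \<alpha>"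
    and "p = q \<longleftrightarrow> odd (\<alpha> - \<beta>)" "\<alpha> = Suc \<beta> \<Longrightarrow> x = y \<or> step p x y"
  shows "\<exists>as' bs'. subseq as' zs \<and> subseq bs' zs \<and> length as' + length bs' = length as + length bs \<and>
    turns p (x # as') < \<alpha> \<and> turns q (y # bs') \<le> Suc \<beta>"
  using assms
proof (induction zs arbitrary: x y as bs p q \<alpha> \<beta>)
  case Nil
  then have "as = []" "bs = []" by (auto dest: list_emb_Nil2)
  with Nil.prems(8) show ?case by simp
next
  case (Cons z zs)
  have dist: "distinct zs" "z \<notin> set zs" "x \<notin> set zs" "y \<notin> set zs" "x \<noteq> z" "y \<noteq> z"
    using Cons.prems(1-3) by auto
  let ?goal = "\<exists>as' bs'. subseq as' (z # zs) \<and> subseq bs' (z # zs) \<and>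
    length as' + length bs' = length as + length bs \<and>
    turns p (x # as') < \<alpha> \<and> turns q (y # bs') \<le> Suc \<beta>"
  have swap: ?goal if "turns p (x # bs) < \<alpha>" "turns q (y # as) \<le> Suc \<beta>"
    using that Cons.prems(4,5) by (intro exI[of _ bs] exI[of _ as]) auto
  consider (both) as1 bs1 where "as = z # as1" "bs = z # bs1" "subseq as1 zs" "subseq bs1 zs"
    | (left) as1 where "as = z # as1" "subseq as1 zs" "subseq bs zs"
    | (right) bs1 where "bs = z # bs1" "subseq bs1 zs" "subseq as zs"
    | (none) "subseq as zs" "subseq bs zs"
    using Cons.prems(4,5) by (cases as; cases bs) (auto split: if_splits)
  then show ?goal
  proof cases
    case both
    define p' where "p' = (if step p x z then p else \<not> p)"
    define \<alpha>' where "\<alpha>' = (if step p x z then \<alpha> else \<alpha> - 1)"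
    define q' where "q' = (if step q y z then q else \<not> q)"
    define \<beta>' where "\<beta>' = (if step q y z then \<beta> else \<beta> - 1)"
    have "turns p' (z # as1) \<le> \<alpha>'" "turns q' (z # bs1) \<le> \<beta>'"
      using Cons.prems(6,7) both by (auto simp: p'_def \<alpha>'_def q'_def \<beta>'_def)
    moreover have "\<beta>' < \<alpha>'"
    \<comment> \<open>The order could only fail if \<open>A\<close> turned at \<open>z\<close> while
      \<open>B\<close> went straight on; but \<open>A\<close> is not ahead of \<open>B\<close>, so
      whatever continues \<open>B\<close> continues \<open>A\<close> too.\<close>
    proof (rule ccontr)
      assume "\<not> \<beta>' < \<alpha>'"
      then have "\<alpha> = Suc \<beta>" "\<not> step p x z" "step q y z"
        using Cons.prems(8) Cons.prems(7) both
        by (auto simp: \<alpha>'_def \<beta>'_def split: if_splits)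
      with Cons.prems(9,10) show False by (auto dest: step_trans)
    qed
    moreover have "p' = q' \<longleftrightarrow> odd (\<alpha>' - \<beta>')"
      using Cons.prems(6-9) both \<open>\<beta>' < \<alpha>'\<close>
      by (auto simp: p'_def \<alpha>'_def q'_def \<beta>'_def split: if_splits)
    ultimately obtain as' bs' where "subseq as' zs" "subseq bs' zs"
      "length as' + length bs' = length as1 + length bs1"
      "turns p' (z # as') < \<alpha>'" "turns q' (z # bs') \<le> Suc \<beta>'"
      using Cons.IH[of z z as1 bs1 p' \<alpha>' q' \<beta>'] dist both by blast
    moreover have "turns p (x # z # as') < \<alpha>" "turns q (y # z # bs') \<le> Suc \<beta>"
      using calculation(4,5) Cons.prems(6,7) both
      by (auto simp: p'_def \<alpha>'_def q'_def \<beta>'_def split: if_splits)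
    ultimately show ?thesis
      using both by (intro exI[of _ "z # as'"] exI[of _ "z # bs'"]) auto
  next
    case left
    define p' where "p' = (if step p x z then p else \<not> p)"
    define \<alpha>' where "\<alpha>' = (if step p x z then \<alpha> else \<alpha> - 1)"
    have A: "turns p' (z # as1) \<le> \<alpha>'"
      using Cons.prems(6) left by (auto simp: p'_def \<alpha>'_def)
    show ?thesis
    \<comment> \<open>The condition says that the invariant survives the move of \<open>A\<close> to
      \<open>z\<close>. If it does not, this is the moment to swap tails.\<close>
    proof (cases "\<beta> < \<alpha>' \<and> (\<alpha>' = Suc \<beta> \<longrightarrow> step p' z y)")
      case True
      moreover have "p' = q \<longleftrightarrow> odd (\<alpha>' - \<beta>)"
        using Cons.prems(6,8,9) True
        by (auto simp: p'_def \<alpha>'_def split: if_splits)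
      ultimately obtain as' bs' where "subseq as' zs" "subseq bs' zs"
        "length as' + length bs' = length as1 + length bs"
        "turns p' (z # as') < \<alpha>'" "turns q (y # bs') \<le> Suc \<beta>"
        using Cons.IH[of z y as1 bs p' \<alpha>' q \<beta>] dist left A Cons.prems(7) by blast
      moreover have "turns p (x # z # as') < \<alpha>"
        using calculation(4) by (auto simp: p'_def \<alpha>'_def split: if_splits)
      ultimately show ?thesis
        using left by (intro exI[of _ "z # as'"] exI[of _ bs']) auto
    next
      case False
      show ?thesis
      proof (cases "\<alpha> = Suc \<beta>")
        \<comment> \<open>Both paths move in direction \<open>p\<close> with \<open>A\<close> not
          ahead, so \<open>A\<close> can take over the tail of \<open>B\<close> for free. Either
          \<open>z\<close> lies beyond \<open>y\<close>, or \<open>A\<close> turns at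
          \<open>z\<close> and so does \<open>B\<close> when it takes over.\<close>
        case True
        with Cons.prems(9,10) have pq: "p = q" "x = y \<or> step p x y" by auto
        have "turns p (x # bs) < \<alpha>"
          using turns_mono[of p x y bs] pq True Cons.prems(7) by auto
        moreover have "turns q (y # as) \<le> Suc \<beta>"
        proof (cases "step p x z")
          case True
          then have "\<not> step p z y"
            using False \<open>\<alpha> = Suc \<beta>\<close> by (simp add: p'_def \<alpha>'_def)
          then have "step p y z" using dist step_linear[of z y p] by simp
          with True show ?thesis
            using \<open>\<alpha> = Suc \<beta>\<close> pq(1) Cons.prems(6) left by simp
        next
          case False
          then have "\<not> step p y z" using pq(2) step_trans[of p x y z] by auto
          with False show ?thesis
            using \<open>\<alpha> = Suc \<beta>\<close> pq(1) Cons.prems(6) left by simp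
        qed
        ultimately show ?thesis by (rule swap)
      next
        case neq: False
        \<comment> \<open>\<open>A\<close> has just turned into the direction of \<open>B\<close>
          and is not behind it, so \<open>B\<close> reaches \<open>z\<close> straight on, while
          \<open>A\<close> pays one turn to join the tail of \<open>B\<close>.\<close>
        have *: "\<not> step p x z" "\<alpha> = Suc (Suc \<beta>)" "\<not> step p' z y"
          using False neq Cons.prems(8) by (auto simp: p'_def \<alpha>'_def split: if_splits)
        then have q: "q = (\<not> p)" "p' = q" using Cons.prems(9) by (auto simp: p'_def)
        have "turns p (x # bs) < \<alpha>"
          using turns_Cons_Not_le[of q x bs y] q * Cons.prems(7) by auto
        moreover have "turns q (y # as) \<le> Suc \<beta>"
          using * q A left dist step_linear[of z y q] by (auto simp: \<alpha>'_def)
        ultimately show ?thesis by (rule swap)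
      qed
    qed
  next
    case right
    define q' where "q' = (if step q y z then q else \<not> q)"
    define \<beta>' where "\<beta>' = (if step q y z then \<beta> else \<beta> - 1)"
    have B: "turns q' (z # bs1) \<le> \<beta>'"
      using Cons.prems(7) right by (auto simp: q'_def \<beta>'_def)
    have "\<beta>' < \<alpha>" using Cons.prems(8) by (auto simp: \<beta>'_def)
    moreover have "p = q' \<longleftrightarrow> odd (\<alpha> - \<beta>')"
      using Cons.prems(7-9) right
      by (auto simp: q'_def \<beta>'_def split: if_splits)
    moreover have "x = z \<or> step p x z" if "\<alpha> = Suc \<beta>'"
      using that Cons.prems(7-10) right step_trans[of p x y z]
      by (auto simp: \<beta>'_def split: if_splits)
    ultimately obtain as' bs' where "subseq as' zs" "subseq bs' zs"
      "length as' + length bs' = length as + length bs1"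
      "turns p (x # as') < \<alpha>" "turns q' (z # bs') \<le> Suc \<beta>'"
      using Cons.IH[of x z as bs1 p \<alpha> q' \<beta>'] dist right B Cons.prems(6) by blast
    moreover have "turns q (y # z # bs') \<le> Suc \<beta>"
      using calculation(5) Cons.prems(7) right by (auto simp: q'_def \<beta>'_def split: if_splits)
    ultimately show ?thesis
      using right by (intro exI[of _ as'] exI[of _ "z # bs'"]) auto
  next
    case none
    then show ?thesis
      using Cons.IH[OF dist(1,3,4) none Cons.prems(6-10)] by (meson list_emb_Cons)
  qed
qed

section \<open>Optimal lengths under a turn budget\<close>

definition best :: "bool \<Rightarrow> nat \<Rightarrow> 'a::linorder list \<Rightarrow> nat" where
  "best s j zs = Max (length ` {bs. subseq bs zs \<and> turns s bs \<le> j})"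

lemma finite_subseq: "finite {bs. subseq bs zs}"
  by (metis List.finite_set set_subseqs_eq)

lemma length_le_best: "subseq bs zs \<Longrightarrow> turns s bs \<le> j \<Longrightarrow> length bs \<le> best s j zs"
  unfolding best_def by (intro Max_ge) (auto simp: finite_subseq)

lemma best_attained:
  obtains bs where "subseq bs zs" "turns s bs \<le> j" "length bs = best s j zs"
proof -
  have "best s j zs \<in> length ` {bs. subseq bs zs \<and> turns s bs \<le> j}"
    unfolding best_def by (intro Max_in) (auto simp: finite_subseq intro!: exI[of _ "[]"])
  with that show ?thesis by auto
qed

lemma best_mono: "i \<le> j \<Longrightarrow> best s i zs \<le> best s j zs"
  by (metis best_attained length_le_best order_trans)

lemma ex_step_to_all:
  fixes A :: "'a::{linorder,no_top,no_bot} set"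
  assumes "finite A"
  shows "\<exists>x. \<forall>a\<in>A. step s x a"
  using assms
proof (induction A rule: finite_induct)
  case (insert b A)
  then obtain x where x: "\<forall>a\<in>A. step s x a" by blast
  have "\<exists>c. step s c x \<and> step s c b"
    using gt_ex[of "max x b"] lt_ex[of "min x b"] by (cases s) (auto simp: step_def)
  then obtain c where "step s c x" "step s c b" by blast
  with x show ?case by (auto intro: step_trans)
qed auto

text \<open>Exchanging tails of optimal paths with budgets \<open>j + 2\<close> and \<open>j\<close>
  evens the budgets out to \<open>j + 1\<close> each. This is a concavity across the two initial
  directions.\<close>

lemma best_exchange:
  fixes zs :: "'a::{linorder,no_top,no_bot} list"
  assumes "distinct zs"
  shows "best (\<not> s) (Suc (Suc j)) zs + best s j zs \<le> best (\<not> s) (Suc j) zs + best s (Suc j) zs"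
proof -
  obtain as where as: "subseq as zs" "turns (\<not> s) as \<le> Suc (Suc j)"
    "length as = best (\<not> s) (Suc (Suc j)) zs" by (rule best_attained)
  obtain bs where bs: "subseq bs zs" "turns s bs \<le> j" "length bs = best s j zs"
    by (rule best_attained)
  obtain x where x: "\<forall>a\<in>set zs. step (\<not> s) x a" using ex_step_to_all by blast
  obtain y where y: "\<forall>a\<in>set zs. step s y a" using ex_step_to_all by blast
  \<comment> \<open>\<open>x\<close> and \<open>y\<close> are virtual starting points beyond all entries\<close>
  have start: "turns r (z # cs) = turns r cs" if "\<forall>a\<in>set zs. step r z a" "subseq cs zs"
    for r z and cs :: "'a list"
  proof (cases cs)
    case (Cons c ds)
    with that have "c \<in> set zs" by (auto dest: list_emb_set)
    with Cons that show ?thesis by simp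
  qed simp
  have "x \<notin> set zs" "y \<notin> set zs" using x y by (auto simp: step_def split: if_splits)
  then obtain as' bs' where "subseq as' zs" "subseq bs' zs"
    "length as' + length bs' = length as + length bs"
    "turns (\<not> s) (x # as') < Suc (Suc j)" "turns s (y # bs') \<le> Suc j"
    using exchange[of zs x y as bs "\<not> s" "Suc (Suc j)" s j] assms as bs start x y by auto
  then show ?thesis
    using length_le_best[of as' zs "\<not> s" "Suc j"] length_le_best[of bs' zs s "Suc j"]
      start x y as bs by simp
qed

subsection \<open>Penalised labels\<close>

text \<open>
  The price of a turn depends only on the direction before the turn, so that peaks cost
  \<open>l True\<close> and valleys \<open>l False\<close>.
\<close>

primrec pen :: "(bool \<Rightarrow> nat) \<Rightarrow> bool \<Rightarrow> nat \<Rightarrow> nat" where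
  "pen l s 0 = 0"
| "pen l s (Suc j) = l s + pen l (\<not> s) j"

text \<open>After \<open>j\<close> turns the direction is \<open>s = even j\<close>; the last turn
  is priced by it.\<close>

lemma pen_Suc_right: "pen l s (Suc j) = pen l s j + l (s = even j)"
proof (induction j arbitrary: s)
  case (Suc j)
  have "pen l s (Suc (Suc j)) = l s + pen l (\<not> s) (Suc j)" by simp
  also have "\<dots> = l s + (pen l (\<not> s) j + l ((\<not> s) = even j))" by (simp only: Suc.IH)
  also have "\<dots> = pen l s (Suc j) + l ((\<not> s) = even j)" by simp
  also have "((\<not> s) = even j) = (s = even (Suc j))" by auto
  finally show ?case .
qed simp

lemma pen_even: "pen l s (2 * m) = m * (l True + l False)"
  by (induction m; cases s) auto

lemma pen_odd: "pen l s (Suc (2 * m)) = l s + m * (l True + l False)"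
  by (simp add: pen_even)

text \<open>
  The initial direction \<open>r = even i\<close> is the one for which turn number \<open>i\<close> (counted from 0)
  happens on a run in direction \<open>r\<close>. Only with this alternation are the gains monotone in \<open>i\<close>;
  for a fixed initial direction they need not be.
\<close>

definition gain :: "'a::linorder list \<Rightarrow> nat \<Rightarrow> bool \<Rightarrow> nat" where
  "gain zs i r = best (r = even i) (Suc i) zs - best (r = even i) i zs"

lemma gain_antimono:
  fixes zs :: "'a::{linorder,no_top,no_bot} list"
  assumes "distinct zs" "i \<le> j"
  shows "gain zs j r \<le> gain zs i r"
  using assms(2)
proof (rule lift_Suc_antimono_le[of "\<lambda>i. gain zs i r", rotated])
  fix i
  \<comment> \<open>Consecutive gains thus refer to opposite initial directions, which is the form
    of \<open>best_exchange\<close>. Monotonicity of \<open>best\<close> keeps the subtraction of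
    naturals from truncating.\<close>
  have "(r = even (Suc i)) = (\<not> (r = even i))" by auto
  then show "gain zs (Suc i) r \<le> gain zs i r"
    using best_exchange[OF assms(1), of "r = even i" i]
      best_mono[of i "Suc i" "r = even i" zs] by (simp add: gain_def)
qed

text \<open>With the gains at \<open>k\<close> as prices, one more turn after \<open>j\<close>
  changes the penalised length by the gain at \<open>j\<close> minus the gain at \<open>k\<close>.
  This is nonnegative for \<open>j < k\<close> and nonpositive from \<open>k\<close> on, for both
  initial directions at once.\<close>

lemma best_minus_pen_le:
  fixes zs :: "'a::{linorder,no_top,no_bot} list"
  assumes "distinct zs"
  shows "int (best s j zs) - int (pen (gain zs k) s j)
    \<le> int (best s k zs) - int (pen (gain zs k) s k)"
proof -
  define f where "f j = int (best s j zs) - int (pen (gain zs k) s j)" for j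
  have f_Suc: "f (Suc j) - f j = int (gain zs j (s = even j)) - int (gain zs k (s = even j))" for j
    using best_mono[of j "Suc j" s zs]
    by (cases s; cases "even j") (simp_all add: f_def pen_Suc_right gain_def del: pen.simps)
  have "f j \<le> f k"
  proof (cases "j \<le> k")
    case True
    then show ?thesis
    proof (induction rule: inc_induct)
      case (step i)
      then show ?case using f_Suc[of i] gain_antimono[OF assms, of i k "s = even i"] by linarith
    qed simp
  next
    case False
    then have "k \<le> j" by simp
    then show ?thesis
    proof (induction rule: dec_induct)
      case (step i)
      then show ?case using f_Suc[of i] gain_antimono[OF assms, of k i "s = even i"] by linarith
    qed simp
  qed
  then show ?thesis by (simp add: f_def)
qed

text \<open>A Lagrangian value of paths from \<open>x\<close> into the later entries
  \<open>zs\<close>: the price of turns replaces the bound on their number.\<close>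

definition label :: "(bool \<Rightarrow> nat) \<Rightarrow> bool \<Rightarrow> 'a::linorder \<Rightarrow> 'a list \<Rightarrow> int" where
  "label l s x zs =
    Max ((\<lambda>bs. int (Suc (length bs)) - int (pen l s (turns s (x # bs)))) ` {bs. subseq bs zs})"

lemma label_ge:
  "subseq bs zs \<Longrightarrow> int (Suc (length bs)) - int (pen l s (turns s (x # bs))) \<le> label l s x zs"
  unfolding label_def by (intro Max_ge) (auto simp: finite_subseq)

lemma label_attained:
  obtains bs where "subseq bs zs"
    "label l s x zs = int (Suc (length bs)) - int (pen l s (turns s (x # bs)))"
proof -
  have "label l s x zs \<in> (\<lambda>bs. int (Suc (length bs)) - int (pen l s (turns s (x # bs)))) ` {bs. subseq bs zs}"
    unfolding label_def by (intro Max_in) (auto simp: finite_subseq intro!: exI[of _ "[]"])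
  with that show ?thesis by auto
qed

lemma label_ge_1: "1 \<le> label l s x zs"
  using label_ge[of "[]" zs l s x] by simp

lemma label_step:
  assumes "step s x y" "subseq (y # ws) zs"
  shows "label l s y ws < label l s x zs"
proof -
  obtain bs where "subseq bs ws"
    "label l s y ws = int (Suc (length bs)) - int (pen l s (turns s (y # bs)))"
    by (rule label_attained)
  moreover from this have "subseq (y # bs) zs"
    using assms(2) subseq_Cons2 subseq_order.trans by blast
  ultimately show ?thesis using label_ge[of "y # bs" zs l s x] assms(1) by simp
qed

text \<open>The same path serves for both initial directions; changing the direction at
  \<open>x\<close> costs at most one turn priced \<open>l s\<close>.\<close>

lemma label_Not:
  assumes "x \<notin> set zs"
  shows "label l (\<not> s) x zs \<le> label l s x zs + int (l s)"
proof -
  obtain bs where bs: "subseq bs zs"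
    "label l (\<not> s) x zs = int (Suc (length bs)) - int (pen l (\<not> s) (turns (\<not> s) (x # bs)))"
    by (rule label_attained)
  have "pen l s (turns s (x # bs)) \<le> pen l (\<not> s) (turns (\<not> s) (x # bs)) + l s"
  proof (cases bs)
    case (Cons b cs)
    with bs(1) assms have "x \<noteq> b" by (auto dest: list_emb_set)
    with Cons show ?thesis by (simp add: step_Not)
  qed simp
  with bs label_ge[OF bs(1), of l s x] show ?thesis by linarith
qed

lemma label_le:
  fixes zs :: "'a::{linorder,no_top,no_bot} list"
  assumes "distinct zs" "subseq (x # ws) zs"
  shows "label (gain zs k) s x ws \<le> int (best s k zs) - int (pen (gain zs k) s k)"
proof -
  obtain bs where bs: "subseq bs ws" "label (gain zs k) s x ws =
      int (Suc (length bs)) - int (pen (gain zs k) s (turns s (x # bs)))"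
    by (rule label_attained)
  then have "subseq (x # bs) zs"
    using assms(2) subseq_Cons2 subseq_order.trans by blast
  then have "Suc (length bs) \<le> best s (turns s (x # bs)) zs"
    using length_le_best[of "x # bs" zs s "turns s (x # bs)"] by simp
  with bs best_minus_pen_le[OF assms(1), of s "turns s (x # bs)" k] show ?thesis by linarith
qed

definition band :: "int \<Rightarrow> int \<Rightarrow> int \<Rightarrow> int \<Rightarrow> (int \<times> int) set" where
  "band a b u d = {(p, q). 1 \<le> p \<and> p \<le> a \<and> 1 \<le> q \<and> q \<le> b \<and> p - q \<le> d \<and> q - p \<le> u}"

lemma finite_band: "finite (band a b u d)"
  by (rule finite_subset[of _ "{1..a} \<times> {1..b}"]) (auto simp: band_def)

text \<open>An argument of Erdos-Szekeres type: of two entries the earlier one has a larger label in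
  the direction leading to the later one, so the label pairs are distinct.\<close>

lemma length_le_card_band:
  fixes zs :: "'a::{linorder,no_top,no_bot} list" and k :: nat
  assumes "distinct zs"
  defines "l \<equiv> gain zs k"
  shows "length zs \<le> card (band (int (best True k zs) - int (pen l True k))
    (int (best False k zs) - int (pen l False k)) (int (l True)) (int (l False)))"
proof -
  define L where "L s i = label l s (zs ! i) (drop (Suc i) zs)" for s i
  have tl: "subseq (zs ! j # drop (Suc j) zs) (drop (Suc i) zs)" if "i < j" "j < length zs" for i j
  proof -
    have "zs ! j # drop (Suc j) zs = drop (j - Suc i) (drop (Suc i) zs)"
      using that by (simp add: Cons_nth_drop_Suc)
    then show ?thesis by (metis suffix_drop suffix_imp_subseq)
  qed
  have tl0: "subseq (zs ! i # drop (Suc i) zs) zs" if "i < length zs" for i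
    using that by (metis Cons_nth_drop_Suc suffix_drop suffix_imp_subseq)
  have less: "L True j < L True i \<or> L False j < L False i" if "i < j" "j < length zs" for i j
  proof -
    have "zs ! i \<noteq> zs ! j" using that assms(1) by (simp add: nth_eq_iff_index_eq)
    then have "step True (zs ! i) (zs ! j) \<or> step False (zs ! i) (zs ! j)"
      by (auto simp: step_def)
    then show ?thesis unfolding L_def using label_step tl[OF that] by blast
  qed
  have "inj_on (\<lambda>i. (L True i, L False i)) {..<length zs}"
    by (rule linorder_inj_onI) (use less in force)+
  moreover have "(\<lambda>i. (L True i, L False i)) ` {..<length zs} \<subseteq>
    band (int (best True k zs) - int (pen l True k))
    (int (best False k zs) - int (pen l False k)) (int (l True)) (int (l False))"
  proof (clarsimp simp: band_def)
    fix i assume i: "i < length zs"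
    have "zs ! i \<notin> set (drop (Suc i) zs)"
      using assms(1) i by (metis Cons_nth_drop_Suc distinct.simps(2) distinct_drop)
    note * = label_Not[OF this, of l]
    show "1 \<le> L True i \<and> L True i \<le> int (best True k zs) - int (pen l True k) \<and>
      1 \<le> L False i \<and> L False i \<le> int (best False k zs) - int (pen l False k) \<and>
      L True i - L False i \<le> int (l False) \<and> L False i - L True i \<le> int (l True)"
      using label_ge_1[of l _ "zs ! i" "drop (Suc i) zs"] *[of True] *[of False]
        label_le[OF assms(1) tl0[OF i], of k] unfolding L_def l_def by auto
  qed
  ultimately show ?thesis
    using card_inj_on_le[OF _ _ finite_band] by fastforce
qed

subsection \<open>Lattice points in a hexagon\<close>

text \<open>Counts the corner that the constraint \<open>p - q \<le> l\<close> cuts off a box of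
  width \<open>l + 1 + z\<close>.\<close>

lemma card_triangle:
  fixes l z :: int
  assumes "0 \<le> z"
  shows "2 * int (card {(p, q). 1 \<le> q \<and> q + l < p \<and> p \<le> l + 1 + z}) = z * (z + 1)"
  using assms
proof (induction z rule: int_ge_induct)
  case base
  have "{(p, q). 1 \<le> q \<and> q + l < p \<and> p \<le> l + 1 + 0} = ({} :: (int \<times> int) set)" by auto
  then show ?case by (metis card.empty mult_zero_left mult_zero_right of_nat_0)
next
  case (step z)
  let ?T = "\<lambda>z. {(p, q). 1 \<le> q \<and> q + l < p \<and> p \<le> l + 1 + z}"
  have "?T (z + 1) = ?T z \<union> {l + 2 + z} \<times> {1..z + 1}" by auto
  moreover have "finite (?T z)"
    by (rule finite_subset[of _ "{l + 1..l + 1 + z} \<times> {1..z + 1}"]) auto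
  moreover have "?T z \<inter> {l + 2 + z} \<times> {1..z + 1} = {}" by auto
  ultimately have "card (?T (z + 1)) = card (?T z) + nat (z + 1)"
    by (simp add: card_Un_disjoint)
  with step show ?case by (simp add: algebra_simps)
qed

text \<open>The box minus two disjoint corner triangles. The hypotheses keep the triangles inside
  the box and their sizes at least -1, where the triangle formula still gives 0.\<close>

lemma card_band_le:
  assumes "0 \<le> a" "0 \<le> b" "0 \<le> u" "0 \<le> d" "d \<le> a" "u \<le> b" "a \<le> b + d + 1" "b \<le> a + u + 1"
  shows "2 * int (card (band a b u d)) \<le> 2 * a * b - (a - 1 - d) * (a - d) - (b - 1 - u) * (b - u)"
proof -
  define T where "T l z = {(p, q). 1 \<le> q \<and> q + l < p \<and> p \<le> l + 1 + z}" for l z :: int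
  have T: "2 * int (card (T l z)) = z * (z + 1)" if "- 1 \<le> z" for l z
  proof (cases "z = - 1")
    case True
    then have "T l z = {}" by (auto simp: T_def)
    with True show ?thesis by simp
  next
    case False
    with that show ?thesis unfolding T_def by (intro card_triangle) simp
  qed
  define A where "A = T d (a - 1 - d)"
  define B where "B = prod.swap ` T u (b - 1 - u)"
  have sub: "A \<subseteq> {1..a} \<times> {1..b}" "B \<subseteq> {1..a} \<times> {1..b}" "band a b u d \<subseteq> {1..a} \<times> {1..b}"
    using assms by (auto simp: A_def B_def T_def band_def)
  then have fin: "finite A" "finite B"
    by (meson finite_SigmaI finite_atLeastAtMost_int finite_subset)+
  have disj: "A \<inter> B = {}" "(A \<union> B) \<inter> band a b u d = {}"
    using assms by (auto simp: A_def B_def T_def band_def)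
  have "card A + card B + card (band a b u d) = card (A \<union> B \<union> band a b u d)"
    using fin disj finite_band by (simp add: card_Un_disjoint)
  also have "\<dots> \<le> card ({1..a} \<times> {1..b})"
    using sub by (intro card_mono) auto
  also have "\<dots> = nat a * nat b" by simp
  finally have "int (card A) + int (card B) + int (card (band a b u d)) \<le> a * b"
    using assms(1,2) by (smt (verit) int_nat_eq of_nat_add of_nat_le_iff of_nat_mult)
  moreover have "card B = card (T u (b - 1 - u))"
    unfolding B_def by (rule card_image) simp
  ultimately show ?thesis
    using T[of "a - 1 - d" d] T[of "b - 1 - u" u] assms by (simp add: A_def algebra_simps)
qed

lemma card_band_even:
  fixes a b t u d :: int and m :: nat
  assumes "0 \<le> u" "0 \<le> d" "a \<le> t - m * (u + d)" "b \<le> t - m * (u + d)"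
    and "0 \<le> t - m * (u + d)"
  shows "4 * (4 * m + 1) * int (card (band a b u d)) \<le> (2 * t + 2 * m)\<^sup>2 + 4 * m + 1"
proof (cases "t - m * (u + d) = 0")
  case True
  then have "band a b u d = {}" using assms by (auto simp: band_def)
  then show ?thesis by simp
next
  case False
  define T where "T = t - m * (u + d)"
  \<comment> \<open>Differences in a box of side \<open>T\<close> never exceed \<open>T - 1\<close>,
    so capping loses no points and makes \<open>card_band_le\<close> applicable.\<close>
  define D where "D = min d (T - 1)"
  define U where "U = min u (T - 1)"
  define w where "w = U + D + 1"
  have T: "1 \<le> T" "T \<le> t - m * (w - 1)"
  proof -
    show "1 \<le> T" using False assms by (simp add: T_def)
    have "U + D \<le> u + d" by (simp add: U_def D_def)
    then have "m * (U + D) \<le> m * (u + d)" by (simp add: mult_left_mono)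
    then show "T \<le> t - m * (w - 1)" by (simp add: T_def w_def)
  qed
  have U: "0 \<le> U" "0 \<le> D" "U \<le> T" "D \<le> T" using T assms by (auto simp: U_def D_def)
  have "band a b u d \<subseteq> band T T U D"
    using assms by (auto simp: band_def T_def U_def D_def)
  then have "card (band a b u d) \<le> card (band T T U D)"
    by (intro card_mono finite_band)
  then have "2 * int (card (band a b u d)) \<le> 2 * T * T - (T - 1 - D) * (T - D) - (T - 1 - U) * (T - U)"
    using card_band_le[of T T U D] T U by linarith
  moreover have "2 * (2 * T * T - (T - 1 - D) * (T - D) - (T - 1 - U) * (T - U)) = 4 * T * w - w\<^sup>2 + 1 - (U - D)\<^sup>2"
    by (simp add: w_def power2_eq_square algebra_simps)
  ultimately have c: "4 * int (card (band a b u d)) \<le> 4 * T * w - w\<^sup>2 + 1"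
    by (smt (verit) zero_le_power2)
  have "T * w \<le> (t - m * (w - 1)) * w"
    using T U by (intro mult_right_mono) (auto simp: w_def)
  with c have "4 * int (card (band a b u d)) \<le> 4 * ((t - m * (w - 1)) * w) - w\<^sup>2 + 1" by linarith
  then have "(4 * m + 1) * (4 * int (card (band a b u d))) \<le> (4 * m + 1) * (4 * ((t - m * (w - 1)) * w) - w\<^sup>2 + 1)"
    by (intro mult_left_mono) auto
  \<comment> \<open>Completing the square in the number \<open>w\<close> of diagonals; the dropped
    square vanishes at the best width.\<close>
  also have "\<dots> = (2 * t + 2 * m)\<^sup>2 + 4 * m + 1 - (2 * t + 2 * m - (4 * m + 1) * w)\<^sup>2"
    by (simp add: power2_eq_square algebra_simps)
  also have "\<dots> \<le> (2 * t + 2 * m)\<^sup>2 + 4 * m + 1" by simp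
  finally show ?thesis by (simp only: mult_ac)
qed

lemma card_band_odd:
  fixes a b t u d :: int and m :: nat
  assumes "0 \<le> u" "0 \<le> d" "a \<le> t - u - m * (u + d)" "b \<le> t - d - m * (u + d)"
    and "0 \<le> t - u - m * (u + d)" "0 \<le> t - d - m * (u + d)"
  shows "4 * (4 * m + 3) * int (card (band a b u d)) \<le> (2 * t + 2 * m + 1)\<^sup>2 + 4 * m + 3"
proof -
  define A where "A = t - u - m * (u + d)"
  define B where "B = t - d - m * (u + d)"
  \<comment> \<open>\<open>z\<close> also equals \<open>B - u\<close>, so both cut corners have the
    same size \<open>z - 1\<close>.\<close>
  define z where "z = A - d"
  have B: "B = z + u" "A = z + d" "A \<ge> 0" "B \<ge> 0" using assms by (simp_all add: A_def B_def z_def)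
  have t: "t = z + (u + d) * (m + 1)" by (simp add: z_def A_def algebra_simps)
  have "band a b u d \<subseteq> band A B u d"
    using assms by (auto simp: band_def A_def B_def)
  then have card: "int (card (band a b u d)) \<le> int (card (band A B u d))"
    by (simp add: card_mono finite_band)
  show ?thesis
  proof (cases "0 \<le> z")
    case True
    define w where "w = u + d + 1"
    have "2 * int (card (band a b u d)) \<le> 2 * A * B - (A - 1 - d) * (A - d) - (B - 1 - u) * (B - u)"
      using card card_band_le[of A B u d] B True assms(1,2) by linarith
    then have "4 * int (card (band a b u d)) \<le> 4 * A * B - 4 * (z - 1) * z"
      by (simp add: B algebra_simps)
    also have "\<dots> = 4 * z * w + (u + d)\<^sup>2 - (u - d)\<^sup>2"
      by (simp add: B w_def power2_eq_square algebra_simps)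
    also have "\<dots> \<le> 4 * z * w + (w - 1)\<^sup>2" by (simp add: w_def)
    finally have "(4 * m + 3) * (4 * int (card (band a b u d))) \<le> (4 * m + 3) * (4 * z * w + (w - 1)\<^sup>2)"
      by (intro mult_left_mono) auto
    also have "\<dots> = (2 * t + 2 * m + 1)\<^sup>2 + 4 * m + 3 - (2 * t + 2 * m + 1 - (4 * m + 3) * w)\<^sup>2"
      by (simp add: t w_def power2_eq_square algebra_simps)
    also have "\<dots> \<le> (2 * t + 2 * m + 1)\<^sup>2 + 4 * m + 3" by simp
    finally show ?thesis by (simp only: mult_ac)
  next
    \<comment> \<open>For \<open>z < 0\<close> the diagonal constraints cut nothing off, and the
      whole box is small enough by the inequality of arithmetic and geometric means.\<close>
    case False
    have "card (band A B u d) \<le> card ({1..A} \<times> {1..B})"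
      by (intro card_mono) (auto simp: band_def)
    also have "\<dots> = nat A * nat B" by simp
    finally have "int (card (band a b u d)) \<le> A * B"
      using B card by (smt (verit) int_nat_eq of_nat_le_iff of_nat_mult)
    then have "(4 * m + 3) * (4 * int (card (band a b u d))) \<le> (4 * m + 3) * (4 * (A * B))"
      by (intro mult_left_mono) auto
    also have "\<dots> \<le> (4 * m + 4) * (4 * (A * B))" using B by (intro mult_right_mono) auto
    also have "\<dots> \<le> (4 * m + 4) * (A + B)\<^sup>2"
      using zero_le_power2[of "A - B"]
      by (intro mult_left_mono) (auto simp: power2_eq_square algebra_simps)
    also have "\<dots> \<le> (2 * m + 2)\<^sup>2 * (A + B)\<^sup>2"
      by (intro mult_right_mono zero_le_power2) (simp add: power2_eq_square algebra_simps)
    also have "\<dots> = ((2 * m + 2) * (A + B))\<^sup>2" by (simp add: power_mult_distrib)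
    also have "\<dots> \<le> (2 * t + 2 * m + 1)\<^sup>2"
    proof (rule power_mono)
      have "2 * t = (2 * m + 2) * (A + B) - 2 * z * (2 * m + 1)"
        by (simp add: t B algebra_simps)
      moreover have "z * (2 * m + 1) \<le> 0" using False by (simp add: mult_nonpos_nonneg)
      ultimately show "(2 * m + 2) * (A + B) \<le> 2 * t + 2 * m + 1" by linarith
    qed (use B in simp)
    finally show ?thesis by (simp add: algebra_simps)
  qed
qed

lemma length_le_of_best:
  fixes zs :: "'a::{linorder,no_top,no_bot} list" and k t :: nat
  assumes "distinct zs" "zs \<noteq> []" "best True k zs \<le> t" "best False k zs \<le> t"
  shows "4 * (2 * k + 1) * length zs \<le> (2 * t + k)\<^sup>2 + 2 * k + 1"
proof -
  define l where "l = gain zs k"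
  define u where "u = int (l True)"
  define d where "d = int (l False)"
  define a where "a = int (best True k zs) - int (pen l True k)"
  define b where "b = int (best False k zs) - int (pen l False k)"
  have card: "length zs \<le> card (band a b u d)"
    using length_le_card_band[OF assms(1), of k] by (simp add: l_def u_def d_def a_def b_def)
  then have "band a b u d \<noteq> {}" using assms(2) by auto
  then have pos: "0 \<le> a" "0 \<le> b" by (auto simp: band_def)
  have ud: "0 \<le> u" "0 \<le> d" by (simp_all add: u_def d_def)
  have pen: "a \<le> int t - int (pen l True k)" "b \<le> int t - int (pen l False k)"
    using assms(3,4) by (simp_all add: a_def b_def)
  have "4 * (2 * int k + 1) * int (card (band a b u d)) \<le> (2 * int t + int k)\<^sup>2 + 2 * int k + 1"
  proof (cases "even k")
    case True
    then obtain m where m: "k = 2 * m" by blast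
    have "a \<le> int t - m * (u + d)" "b \<le> int t - m * (u + d)"
      using pen by (simp_all add: m pen_even u_def d_def)
    with pos ud have "4 * (4 * m + 1) * int (card (band a b u d)) \<le> (2 * int t + 2 * m)\<^sup>2 + 4 * m + 1"
      by (intro card_band_even) auto
    then show ?thesis by (simp add: m algebra_simps)
  next
    case False
    then obtain m where m: "k = Suc (2 * m)" by (auto elim: oddE)
    have "a \<le> int t - u - m * (u + d)" "b \<le> int t - d - m * (u + d)"
      using pen by (simp_all add: m pen_odd u_def d_def del: pen.simps)
    with pos ud have "4 * (4 * m + 3) * int (card (band a b u d)) \<le> (2 * int t + 2 * m + 1)\<^sup>2 + 4 * m + 3"
      by (intro card_band_odd) auto
    then show ?thesis by (simp add: m algebra_simps)
  qed
  moreover have "4 * (2 * int k + 1) * int (length zs) \<le> 4 * (2 * int k + 1) * int (card (band a b u d))"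
    using card by (intro mult_left_mono) auto
  ultimately have "4 * (2 * int k + 1) * int (length zs) \<le> (2 * int t + int k)\<^sup>2 + 2 * int k + 1"
    by (rule order_trans[rotated])
  then have "int (4 * (2 * k + 1) * length zs) \<le> int ((2 * t + k)\<^sup>2 + 2 * k + 1)"
    by (simp add: algebra_simps)
  then show ?thesis by (simp only: of_nat_le_iff)
qed

subsection \<open>Few turns and modality\<close>

definition run_between :: "bool \<Rightarrow> real list \<Rightarrow> nat \<Rightarrow> nat \<Rightarrow> bool" where
  "run_between s b l r \<longleftrightarrow> (\<forall>m. l \<le> m \<and> m < r \<longrightarrow> step s (b ! m) (b ! Suc m))"

text \<open>Surplus turns become empty runs at the last position.\<close>

lemma turns_imp_breakpoints:
  assumes "distinct xs" "xs \<noteq> []" "turns s xs \<le> k"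
  shows "\<exists>i. i 0 = 0 \<and> Suc (i (Suc k)) = length xs \<and> (\<forall>j\<le>k. i j \<le> i (Suc j)) \<and>
    (\<forall>j\<le>k. run_between (s = even j) xs (i j) (i (Suc j)))"
  using assms
proof (induction s xs arbitrary: k rule: turns.induct)
  case (2 s x)
  show ?case by (rule exI[of _ "\<lambda>_. 0"]) (simp add: run_between_def)
next
  case (3 s x y zs)
  have prepend: "\<exists>i. i 0 = 0 \<and> Suc (i (Suc k)) = length (x # y # zs) \<and> (\<forall>j\<le>k. i j \<le> i (Suc j)) \<and>
      (\<forall>j\<le>k. run_between (r = even j) (x # y # zs) (i j) (i (Suc j)))"
    if "step r x y" and i: "i 0 = 0" "Suc (i (Suc k)) = length (y # zs)" "\<forall>j\<le>k. i j \<le> i (Suc j)"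
      "\<forall>j\<le>k. run_between (r = even j) (y # zs) (i j) (i (Suc j))" for r k i
  proof (intro exI conjI allI impI)
    \<comment> \<open>All breakpoints but the first shift by one, so the first run absorbs
      \<open>x\<close>.\<close>
    let ?i = "\<lambda>j. if j = 0 then 0 else Suc (i j)"
    show "?i 0 = 0" "Suc (?i (Suc k)) = length (x # y # zs)" using i by auto
    fix j assume j: "j \<le> k"
    show "?i j \<le> ?i (Suc j)" using i j by auto
    show "run_between (r = even j) (x # y # zs) (?i j) (?i (Suc j))"
      unfolding run_between_def
    proof (intro allI impI)
      fix m assume m: "?i j \<le> m \<and> m < ?i (Suc j)"
      show "step (r = even j) ((x # y # zs) ! m) ((x # y # zs) ! Suc m)"
      proof (cases m)
        case 0
        with m that(1) show ?thesis by (auto split: if_splits)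
      next
        case (Suc m')
        with m i(1) have "i j \<le> m'" "m' < i (Suc j)" by (auto split: if_splits)
        then have "step (r = even j) ((y # zs) ! m') ((y # zs) ! Suc m')"
          using i(4) j by (auto simp: run_between_def)
        with Suc show ?thesis by simp
      qed
    qed
  qed
  show ?case
  proof (cases "step s x y")
    case True
    have "distinct (y # zs)" "y # zs \<noteq> []" "turns s (y # zs) \<le> k"
      using True 3(3,5) by auto
    from 3(1)[OF True this] obtain i where "i 0 = 0" "Suc (i (Suc k)) = length (y # zs)"
      "\<forall>j\<le>k. i j \<le> i (Suc j)" "\<forall>j\<le>k. run_between (s = even j) (y # zs) (i j) (i (Suc j))"
      by blast
    from prepend[OF True this] show ?thesis .
  next
    case False
    with 3(3,5) obtain k' where k: "k = Suc k'" "turns (\<not> s) (y # zs) \<le> k'"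
      by (cases k) auto
    have "distinct (y # zs)" "y # zs \<noteq> []" using 3(3) by auto
    from 3(2)[OF False this k(2)] obtain i where
      "i 0 = 0" "Suc (i (Suc k')) = length (y # zs)" "\<forall>j\<le>k'. i j \<le> i (Suc j)"
      "\<forall>j\<le>k'. run_between ((\<not> s) = even j) (y # zs) (i j) (i (Suc j))"
      by blast
    moreover have "step (\<not> s) x y" using False 3(3) by (simp add: step_Not)
    ultimately obtain i where i: "i 0 = 0" "Suc (i (Suc k')) = length (x # y # zs)"
      "\<forall>j\<le>k'. i j \<le> i (Suc j)"
      "\<forall>j\<le>k'. run_between ((\<not> s) = even j) (x # y # zs) (i j) (i (Suc j))"
      using prepend[of "\<not> s" i k'] by blast
    show ?thesis
    proof (intro exI conjI allI impI)
      \<comment> \<open>A turn at the very start is an empty first run in direction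
        \<open>s\<close>.\<close>
      let ?i = "case_nat 0 i"
      show "?i 0 = 0" "Suc (?i (Suc k)) = length (x # y # zs)" using i k by auto
      fix j assume "j \<le> k"
      with i k show "?i j \<le> ?i (Suc j)" by (cases j) auto
      show "run_between (s = even j) (x # y # zs) (?i j) (?i (Suc j))"
      proof (cases j)
        case 0
        with i show ?thesis by (simp add: run_between_def)
      next
        case (Suc j')
        moreover have "(s = even (Suc j')) = ((\<not> s) = even j')" by auto
        ultimately show ?thesis using i(4) \<open>j \<le> k\<close> k by simp
      qed
    qed
  qed
qed simp

lemma turns_imp_k_modal:
  assumes "distinct xs" "xs \<noteq> []" "turns s xs \<le> k"
  shows "k_modal k xs"
proof -
  obtain i where i: "i 0 = 0" "Suc (i (Suc k)) = length xs" "\<forall>j\<le>k. i j \<le> i (Suc j)"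
    "\<forall>j\<le>k. run_between (s = even j) xs (i j) (i (Suc j))"
    using turns_imp_breakpoints[OF assms] by blast
  have "increasing_between xs = run_between True xs" "decreasing_between xs = run_between False xs"
    by (auto simp: fun_eq_iff run_between_def increasing_between_def decreasing_between_def step_def)
  with i show ?thesis
    unfolding k_modal_def by (cases s) (auto intro!: exI[of _ i])
qed

section \<open>From optimal lengths to the lower bound\<close>

lemma turns_take_le: "turns s (take m xs) \<le> turns s xs"
proof (induction s xs arbitrary: m rule: turns.induct)
  case (2 s x)
  show ?case by (cases m) auto
next
  case (3 s x y zs)
  show ?case
  proof (cases m)
    case (Suc m')
    then show ?thesis using 3[of m'] by (cases m') auto
  qed simp
qed simp

text \<open>Cutting an optimal path down to a prefix gives the exact length \<open>t\<close> without
  new turns.\<close>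

lemma has_k_modal_subseq_le_best:
  assumes "distinct a" "1 \<le> t" "t \<le> best s k a"
  shows "has_k_modal_subseq k t a"
proof -
  obtain bs where bs: "subseq bs a" "turns s bs \<le> k" "length bs = best s k a"
    by (rule best_attained)
  have sub: "subseq (take t bs) a"
    using bs(1) by (meson prefix_imp_subseq subseq_order.trans take_is_prefix)
  then have "distinct (take t bs)" using assms(1) by (metis subseq_conv_nths distinct_nthsI)
  moreover have "turns s (take t bs) \<le> k" using turns_take_le bs(2) le_trans by blast
  ultimately have "k_modal k (take t bs)"
    using assms(2,3) bs(3) by (intro turns_imp_k_modal) auto
  moreover have "length (take t bs) = t" using assms(3) bs(3) by simp
  ultimately show ?thesis unfolding has_k_modal_subseq_def using sub by blast
qed

theorem theorem1:
  fixes k n :: nat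
  assumes "n \<ge> 1"
  shows "int (rho n k) \<ge> \<lceil>sqrt ((2 * real k + 1) * (real n - 1 / 4)) - real k / 2\<rceil>"
\<comment> \<open>A nonpositive bound is trivial; otherwise \<open>nat\<close> is exact and
  \<open>t\<close> is at least 1, as nonempty subsequences require.\<close>
proof (cases "\<lceil>sqrt ((2 * real k + 1) * (real n - 1 / 4)) - real k / 2\<rceil> \<le> 0")
  case False
  define t where "t = nat \<lceil>sqrt ((2 * real k + 1) * (real n - 1 / 4)) - real k / 2\<rceil>"
  have t: "1 \<le> t" unfolding t_def using False by linarith
  have "has_k_modal_subseq k t a" if "generic_seq n a" for a
  proof -
    have a: "length a = n" "distinct a" using that by (auto simp: generic_seq_def)
    define T where "T = max (best True k a) (best False k a)"
    have "4 * (2 * k + 1) * n \<le> (2 * T + k)\<^sup>2 + 2 * k + 1"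
      using length_le_of_best[OF a(2), of k T] a(1) assms by (cases "a = []") (auto simp: T_def)
    then have "real (4 * (2 * k + 1) * n) \<le> real ((2 * T + k)\<^sup>2 + 2 * k + 1)"
      by (simp only: of_nat_le_iff)
    then have "(2 * real k + 1) * (real n - 1 / 4) \<le> (real T + real k / 2)\<^sup>2"
      by (simp add: power2_eq_square algebra_simps)
    then have "sqrt ((2 * real k + 1) * (real n - 1 / 4)) \<le> real T + real k / 2"
      by (simp add: real_le_lsqrt)
    then have "t \<le> T" unfolding t_def by (simp add: nat_le_iff ceiling_le_iff)
    then have "t \<le> best True k a \<or> t \<le> best False k a" by (auto simp: T_def)
    then show ?thesis using has_k_modal_subseq_le_best[OF a(2) t] by blast
  qed
  then have "t \<le> rho n k" using rho_greatest[OF assms] by blast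
  then show ?thesis unfolding t_def by linarith
next
  case True
  then show ?thesis by linarith
qed

end
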